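(* Let $n\ge2$, $\alpha>0$, $m\in(0,3)$, and let $u\in C(B_1)$ be a nonnegative viscosity solution of \[ \Delta_\infty u=|x|^\alpha u_+^m\quad\text{in }B_1 . \] Assume that $0\in\partial\{u>0\}$. Then there exists $r^*>0$ such that for all $r\in(0,r^* )$ with $B_r(0)\subset B_1(0)$, \[ \sup_{\partial B_r(0)}u\ \ge\ \left(\frac{(3-m)^4}{(4+\alpha)^3(1+\alpha+m)}\right)^{\frac1{3-m}} r^{\frac{4+\alpha}{3-m}} . \]
   Context: $B_r(x_0)$ is the open ball in $\mathbb{R}^n$ of radius $r$ centered at $x_0$, and $B_1=B_1(0)$. The infinity Laplacian is $\Delta_\infty w=\langle D^2w\,Dw,Dw\rangle=\sum_{i,j}\partial_i w\,\partial_{ij}w\,\partial_j w$, and $t_+=\max\{t,0\}$. A function $u\in C(B_1)$ is a viscosity subsolution (resp. supersolution) of $\Delta_\infty u=|x|^\alpha u_+^m$ in $B_1$ if, whenever $\varphi\in C^2(B_1)$ and $u-\varphi$ has a local maximum (resp. minimum) at $x_0\in B_1$, one has $\Delta_\infty\varphi(x_0)\ge|x_0|^\alpha(u(x_0)_+)^m$ (resp. $\le$). It is a viscosity solution if it is both. $\{u>0\}=\{x\in B_1:u(x)>0\}$. *)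

theory Defs
  imports "HOL-Analysis.Analysis"
begin

text \<open>
  Functions on the open ball \<open>ball 0 1\<close> are represented by total functions on \<open>real ^ 'n\<close>. All
  notions below are local at points of the open ball, so values outside it are irrelevant.
\<close>

definition partial_deriv :: "'n \<Rightarrow> (real ^ 'n \<Rightarrow> real) \<Rightarrow> real ^ 'n \<Rightarrow> real"
  where "partial_deriv i w x = frechet_derivative w (at x) (axis i 1)"

definition gradient :: "(real ^ 'n \<Rightarrow> real) \<Rightarrow> real ^ 'n \<Rightarrow> real ^ 'n"
  where "gradient w x = (\<chi> i. partial_deriv i w x)"

definition hessian :: "(real ^ 'n \<Rightarrow> real) \<Rightarrow> real ^ 'n \<Rightarrow> real ^ 'n ^ 'n"
  where "hessian w x = (\<chi> i j. partial_deriv i (partial_deriv j w) x)"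

definition inf_laplacian :: "(real ^ 'n \<Rightarrow> real) \<Rightarrow> real ^ 'n \<Rightarrow> real"
  where "inf_laplacian w x = (hessian w x *v gradient w x) \<bullet> gradient w x"

text \<open>
  Used for open \<open>S\<close> only. The two differentiability conditions are needed because
  \<^const>\<open>frechet_derivative\<close> is unspecified where the derivative does not
  exist; continuity of \<open>w\<close> and of its gradient follows from them.
\<close>

definition C2_on :: "(real ^ 'n) set \<Rightarrow> (real ^ 'n \<Rightarrow> real) \<Rightarrow> bool"
  where "C2_on S w \<longleftrightarrow>
    (\<forall>x\<in>S. w differentiable (at x)) \<and>
    (\<forall>x\<in>S. \<forall>i. partial_deriv i w differentiable (at x)) \<and>
    continuous_on S (hessian w)"

definition local_max_at :: "('a::topological_space \<Rightarrow> real) \<Rightarrow> 'a \<Rightarrow> bool"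
  where "local_max_at g x \<longleftrightarrow> (\<forall>\<^sub>F y in nhds x. g y \<le> g x)"

definition local_min_at :: "('a::topological_space \<Rightarrow> real) \<Rightarrow> 'a \<Rightarrow> bool"
  where "local_min_at g x \<longleftrightarrow> (\<forall>\<^sub>F y in nhds x. g x \<le> g y)"

definition viscosity_subsolution :: "real \<Rightarrow> real \<Rightarrow> (real ^ 'n \<Rightarrow> real) \<Rightarrow> bool"
  where "viscosity_subsolution \<alpha> m u \<longleftrightarrow>
    continuous_on (ball 0 1) u \<and>
    (\<forall>\<phi> x0. C2_on (ball 0 1) \<phi> \<longrightarrow> x0 \<in> ball 0 1 \<longrightarrow> local_max_at (\<lambda>x. u x - \<phi> x) x0 \<longrightarrow>
       inf_laplacian \<phi> x0 \<ge> norm x0 powr \<alpha> * max (u x0) 0 powr m)"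

definition viscosity_supersolution :: "real \<Rightarrow> real \<Rightarrow> (real ^ 'n \<Rightarrow> real) \<Rightarrow> bool"
  where "viscosity_supersolution \<alpha> m u \<longleftrightarrow>
    continuous_on (ball 0 1) u \<and>
    (\<forall>\<phi> x0. C2_on (ball 0 1) \<phi> \<longrightarrow> x0 \<in> ball 0 1 \<longrightarrow> local_min_at (\<lambda>x. u x - \<phi> x) x0 \<longrightarrow>
       inf_laplacian \<phi> x0 \<le> norm x0 powr \<alpha> * max (u x0) 0 powr m)"

definition viscosity_solution :: "real \<Rightarrow> real \<Rightarrow> (real ^ 'n \<Rightarrow> real) \<Rightarrow> bool"
  where "viscosity_solution \<alpha> m u \<longleftrightarrow>
    viscosity_subsolution \<alpha> m u \<and> viscosity_supersolution \<alpha> m u"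

end

theory Submission
  imports Defs
begin

text \<open>
  Put \<open>\<beta> = (4 + \<alpha>) / (3 - m)\<close>. The radial function \<open>A |x - y|\<^sup>\<sigma>\<close> satisfies, with \<open>\<rho> = |x - y|\<close>,
  \<open>\<Delta>\<^sub>\<infinity> (A \<rho>\<^sup>\<sigma>) = A\<^sup>3 \<sigma>\<^sup>3 (\<sigma> - 1) \<rho>\<^bsup>3\<sigma>-4\<^esup>\<close>. For \<open>y = 0\<close> and \<open>\<sigma> = \<beta>\<close> it solves the
  equation exactly when \<open>A\<close> is the constant of the theorem. It need not be twice differentiable
  at its centre, and the right-hand side of the equation vanishes at \<open>0\<close>.

  The engine is a comparison principle (\<open>subsolution_le_radial_power\<close>): a subsolution that lies
  below such a supersolution on the boundary of a ball about \<open>y\<close> lies below it inside. At an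
  interior point other than \<open>y\<close> where \<open>u - w\<close> attains a positive maximum, \<open>w\<close> has the role of a test
  function, so that \<open>|x|\<^sup>\<alpha> u\<^sup>m \<le> \<Delta>\<^sub>\<infinity> w \<le> |x|\<^sup>\<alpha> w\<^sup>m\<close>, which is impossible when \<open>u > w \<ge> 0\<close>. The centre is
  harmless if \<open>u y \<le> 0\<close>, or if \<open>\<sigma> > 2\<close> and \<open>y \<noteq> 0\<close>.

  Comparison with the exact solution alone does not give the theorem: it only yields \<open>u 0 \<le> 0\<close>.
  Suppose however that the supremum of \<open>u\<close> over the sphere of radius \<open>r\<close> is strictly below the
  bound. By continuity in the exponent there is room for some \<open>\<gamma> > \<beta>\<close> such that a
  multiple of \<open>|x|\<^sup>\<gamma>\<close> is still a supersolution in the ball of radius \<open>r\<close> and dominates \<open>u\<close> on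
  its boundary; hence \<open>u \<le> A |x|\<^sup>\<gamma>\<close> (\<open>subsolution_faster_decay\<close>). So \<open>u\<close> decays faster than the
  natural rate \<open>\<beta>\<close>. For small \<open>y \<noteq> 0\<close> this makes \<open>u\<close> so small on the ball of radius \<open>|y| / 2\<close>
  about \<open>y\<close> that a power of \<open>|x - y|\<close> is a barrier there, which forces \<open>u y \<le> 0\<close>
  (\<open>subsolution_nonpos_near_0\<close>). Thus \<open>u \<le> 0\<close> near \<open>0\<close>, and \<open>0\<close> is not in the closure of
  \<open>{u > 0}\<close>.
\<close>

section \<open>Quadratic polynomials of the squared distance\<close>

lemma sqdist_has_derivative:
  "((\<lambda>x. (x - y) \<bullet> (x - y)) has_derivative (\<lambda>h. 2 * ((x - y) \<bullet> h))) (at x)"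
  by (rule derivative_eq_intros refl)+ (simp add: inner_commute)

text \<open>
  The test functions: polynomials \<open>a + b q + e q\<^sup>2\<close> of \<open>q = |x - y|\<^sup>2\<close>. They are smooth on the whole
  space, and their second-order behaviour at a given point other than \<open>y\<close> can match that of any
  smooth radial function about \<open>y\<close>.
\<close>

definition sqdist_poly :: "real ^ 'n \<Rightarrow> real \<Rightarrow> real \<Rightarrow> real \<Rightarrow> real ^ 'n \<Rightarrow> real"
  where "sqdist_poly y a b e x = a + b * ((x - y) \<bullet> (x - y)) + e * ((x - y) \<bullet> (x - y))\<^sup>2"

lemma sqdist_poly_has_derivative:
  "(sqdist_poly y a b e has_derivative
     (\<lambda>h. (2 * b + 4 * e * ((x - y) \<bullet> (x - y))) * ((x - y) \<bullet> h))) (at x)"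
proof -
  have "((\<lambda>x. a + b * Q x + e * (Q x)\<^sup>2) has_derivative (\<lambda>h. (b + 2 * e * Q x) * Q' h)) (at x)"
    if "(Q has_derivative Q') (at x)" for Q Q'
    using that by (auto intro!: derivative_eq_intros simp: algebra_simps)
  from this [OF sqdist_has_derivative [of y]] show ?thesis
    unfolding sqdist_poly_def [abs_def]
    by (rule has_derivative_eq_rhs) (simp add: fun_eq_iff distrib_right)
qed

lemma partial_deriv_eqI:
  assumes "(w has_derivative D) (at x)"
  shows "partial_deriv i w x = D (axis i 1)"
  using frechet_derivative_at [OF assms] by (simp add: partial_deriv_def)

lemma partial_deriv_sqdist_poly:
  "partial_deriv i (sqdist_poly y a b e) =
     (\<lambda>x. (2 * b + 4 * e * ((x - y) \<bullet> (x - y))) * (x - y) $ i)"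
  by (rule ext) (simp add: partial_deriv_eqI [OF sqdist_poly_has_derivative] inner_axis)

lemma partial_deriv_sqdist_poly_has_derivative:
  "(partial_deriv i (sqdist_poly y a b e) has_derivative
     (\<lambda>h. (2 * b + 4 * e * ((x - y) \<bullet> (x - y))) * h $ i + 8 * e * ((x - y) \<bullet> h) * (x - y) $ i)) (at x)"
proof -
  have R: "((\<lambda>x. (2 * b + 4 * e * Q x) * Z x) has_derivative
      (\<lambda>h. (2 * b + 4 * e * Q x) * Z' h + 4 * e * Q' h * Z x)) (at x)"
    if "(Q has_derivative Q') (at x)" "(Z has_derivative Z') (at x)" for Q Q' Z Z'
    using that by (auto intro!: derivative_eq_intros simp: algebra_simps)
  have "((\<lambda>x. (x - y) $ i) has_derivative (\<lambda>h. h $ i)) (at x)"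
    unfolding vector_minus_component
    using has_derivative_diff [OF bounded_linear_imp_has_derivative [OF bounded_linear_vec_nth]
        has_derivative_const] by simp
  from R [OF sqdist_has_derivative [of y] this] show ?thesis
    unfolding partial_deriv_sqdist_poly
    by (rule has_derivative_eq_rhs) (simp add: fun_eq_iff)
qed

lemma gradient_sqdist_poly:
  "gradient (sqdist_poly y a b e) x = (2 * b + 4 * e * ((x - y) \<bullet> (x - y))) *\<^sub>R (x - y)"
  by (simp add: gradient_def partial_deriv_sqdist_poly vec_eq_iff)

lemma hessian_sqdist_poly:
  "hessian (sqdist_poly y a b e) x =
     (\<chi> i j. (2 * b + 4 * e * ((x - y) \<bullet> (x - y))) * (if i = j then 1 else 0)
            + 8 * e * (x - y) $ i * (x - y) $ j)"
  by (simp add: hessian_def partial_deriv_eqI [OF partial_deriv_sqdist_poly_has_derivative]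
      inner_axis vec_eq_iff) (auto simp: axis_def)

lemma C2_on_sqdist_poly: "C2_on S (sqdist_poly y a b e)"
proof -
  have "continuous_on S (\<lambda>x. hessian (sqdist_poly y a b e) x)"
    unfolding hessian_sqdist_poly by (intro continuous_intros)
  then show ?thesis
    unfolding C2_on_def
    using sqdist_poly_has_derivative partial_deriv_sqdist_poly_has_derivative
    by (blast intro: differentiableI)
qed

lemma inf_laplacian_sqdist_poly:
  fixes y x :: "real ^ 'n"
  defines "q \<equiv> (x - y) \<bullet> (x - y)"
  shows "inf_laplacian (sqdist_poly y a b e) x = (2 * b + 4 * e * q)\<^sup>2 * q * (2 * b + 12 * e * q)"
proof -
  define k where "k = 2 * b + 4 * e * q"
  define z where "z = x - y"
  have q: "q = (\<Sum>j\<in>UNIV. z $ j * z $ j)"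
    by (simp add: q_def z_def inner_vec_def)
  have "hessian (sqdist_poly y a b e) x *v (k *\<^sub>R z) = ((k + 8 * e * q) * k) *\<^sub>R z"
  proof (rule vec_eq_iff [THEN iffD2], rule allI)
    fix i
    have "(hessian (sqdist_poly y a b e) x *v (k *\<^sub>R z)) $ i =
        (\<Sum>j\<in>UNIV. (k * (if i = j then 1 else 0) + 8 * e * z $ i * z $ j) * (k * z $ j))"
      by (simp add: matrix_vector_mult_def hessian_sqdist_poly k_def z_def q_def)
    also have "\<dots> = (\<Sum>j\<in>UNIV. (if i = j then k * k * z $ j else 0))
        + (\<Sum>j\<in>UNIV. 8 * e * z $ i * k * (z $ j * z $ j))"
      by (subst sum.distrib [symmetric], rule sum.cong) (auto simp: algebra_simps)
    also have "\<dots> = k * k * z $ i + 8 * e * z $ i * k * q"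
      by (simp add: q sum_distrib_left)
    finally show "(hessian (sqdist_poly y a b e) x *v (k *\<^sub>R z)) $ i
        = (((k + 8 * e * q) * k) *\<^sub>R z) $ i"
      by (simp add: algebra_simps)
  qed
  then have "inf_laplacian (sqdist_poly y a b e) x = (k + 8 * e * q) * k * k * q"
    unfolding inf_laplacian_def gradient_sqdist_poly
    by (simp add: k_def z_def q_def)
  then show ?thesis
    by (simp add: k_def power2_eq_square algebra_simps)
qed

section \<open>Touching a subsolution from above by a radial power\<close>

text \<open>
  Raising the second Taylor coefficient by \<open>\<delta>\<close> turns the Taylor polynomial into a local upper
  bound. With \<open>q\<close> a squared distance, it replaces a radial power that is not twice differentiable
  at its centre by a polynomial test function.
\<close>

lemma powr_le_quadratic_near:
  fixes p q0 \<delta> :: real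
  assumes "q0 > 0" and "\<delta> > 0"
  shows "\<forall>\<^sub>F q in nhds q0. q powr p \<le> q0 powr p + p * q0 powr (p - 1) * (q - q0)
           + (p * (p - 1) * q0 powr (p - 2) / 2 + \<delta>) * (q - q0)\<^sup>2"
proof -
  define f2 where "f2 t = p * (p - 1) * t powr (p - 2)" for t
  have "isCont f2 q0"
    unfolding f2_def [abs_def] using assms by (intro continuous_intros) auto
  then have "(f2 \<longlongrightarrow> f2 q0) (nhds q0)"
    by (simp add: isCont_def tendsto_at_iff_tendsto_nhds)
  then have "\<forall>\<^sub>F t in nhds q0. f2 t < f2 q0 + 2 * \<delta>"
    using assms by (intro order_tendstoD) auto
  moreover have "\<forall>\<^sub>F t in nhds q0. t > 0"
    using assms by (intro eventually_nhds_in_open [of "{0<..}", simplified]) auto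
  ultimately have "\<forall>\<^sub>F t in nhds q0. t > 0 \<and> f2 t < f2 q0 + 2 * \<delta>"
    by eventually_elim simp
  then obtain r where r: "r > 0" "\<And>t. \<bar>t - q0\<bar> < r \<Longrightarrow> t > 0 \<and> f2 t < f2 q0 + 2 * \<delta>"
    unfolding eventually_nhds_metric by (auto simp: dist_real_def)
  show ?thesis
    unfolding eventually_nhds_metric
  proof (intro exI conjI allI impI)
    fix q assume "dist q q0 < r"
    then have q: "\<bar>q - q0\<bar> < r" by (simp add: dist_real_def)
    show "q powr p \<le> q0 powr p + p * q0 powr (p - 1) * (q - q0)
           + (p * (p - 1) * q0 powr (p - 2) / 2 + \<delta>) * (q - q0)\<^sup>2"
    proof (cases "q = q0")
      case False
      define D where "D n = (if n = 0 then (\<lambda>t. t powr p)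
        else if n = 1 then (\<lambda>t. p * t powr (p - 1)) else f2)" for n :: nat
      have "\<exists>t. (if q < q0 then q < t \<and> t < q0 else q0 < t \<and> t < q) \<and>
        q powr p = (\<Sum>m<2. D m q0 / fact m * (q - q0) ^ m) + D 2 t / fact 2 * (q - q0) ^ 2"
      proof (rule Taylor [where a = "min q q0" and b = "max q q0"])
        show "\<forall>m t. m < 2 \<and> min q q0 \<le> t \<and> t \<le> max q q0 \<longrightarrow> DERIV (D m) t :> D (Suc m) t"
        proof (intro allI impI)
          fix m :: nat and t assume H: "m < 2 \<and> min q q0 \<le> t \<and> t \<le> max q q0"
          then have "\<bar>t - q0\<bar> < r" using q r(1) by (auto simp: min_def max_def split: if_splits)
          then have "t > 0" using r(2) by blast
          moreover have "m = 0 \<or> m = 1" using H by auto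
          ultimately show "DERIV (D m) t :> D (Suc m) t"
            by (auto simp: D_def f2_def intro!: derivative_eq_intros)
        qed
      qed (use False in \<open>auto simp: D_def\<close>)
      then obtain t where t: "if q < q0 then q < t \<and> t < q0 else q0 < t \<and> t < q"
        and eq: "q powr p = (\<Sum>m<2. D m q0 / fact m * (q - q0) ^ m) + D 2 t / fact 2 * (q - q0) ^ 2"
        by blast
      have "\<bar>t - q0\<bar> < r" using t q by (auto split: if_splits)
      then have "f2 t / 2 \<le> f2 q0 / 2 + \<delta>" using r(2) by fastforce
      then have "f2 t / 2 * (q - q0)\<^sup>2 \<le> (f2 q0 / 2 + \<delta>) * (q - q0)\<^sup>2"
        by (intro mult_right_mono) auto
      with eq show ?thesis
        by (simp add: D_def f2_def numeral_2_eq_2)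
    qed auto
  qed (use r in auto)
qed

lemma local_max_at_mono:
  assumes "local_max_at (\<lambda>x. u x - w x) x0"
    and "\<forall>\<^sub>F x in nhds x0. w x \<le> (\<phi> x :: real)" and "\<phi> x0 = w x0"
  shows "local_max_at (\<lambda>x. u x - \<phi> x) x0"
  using assms(1,2) unfolding local_max_at_def
  by eventually_elim (use assms(3) in auto)

lemma norm_powr_eq_sqdist_powr: "norm (x - y) powr \<sigma> = ((x - y) \<bullet> (x - y)) powr (\<sigma> / 2)"
proof -
  have "(x - y) \<bullet> (x - y) = norm (x - y) powr 2"
    by (simp add: dot_square_norm)
  then show ?thesis by (simp only: powr_powr) simp
qed

text \<open>
  The test polynomial of order \<open>\<delta>\<close> gives the inequality up to an error that vanishes as
  \<open>\<delta> \<rightarrow> 0\<close>; the right-hand side is the infinity Laplacian of \<open>A |x - y|\<^sup>\<sigma>\<close> at \<open>x0\<close>.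
\<close>

lemma subsolution_touch_radial_power:
  fixes u :: "real ^ 'n \<Rightarrow> real"
  assumes sub: "viscosity_subsolution \<alpha> m u" and x0: "x0 \<in> ball 0 1" "x0 \<noteq> y" and "A \<ge> 0"
    and max: "local_max_at (\<lambda>x. u x - A * norm (x - y) powr \<sigma>) x0"
  shows "norm x0 powr \<alpha> * max (u x0) 0 powr m
    \<le> A ^ 3 * \<sigma> ^ 3 * (\<sigma> - 1) * norm (x0 - y) powr (3 * \<sigma> - 4)"
proof -
  define Q where "Q x = (x - y) \<bullet> (x - y)" for x
  define q p where "q = Q x0" and "p = \<sigma> / 2"
  have q: "q > 0" using x0 by (simp add: q_def Q_def)
  define b where "b = A * (p * q powr (p - 1))"
  define e where "e \<delta> = A * (p * (p - 1) * q powr (p - 2) / 2 + \<delta>)" for \<delta>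
  \<comment> \<open>The infinity Laplacian at \<open>x0\<close> of the test function \<open>\<phi>\<close> introduced below\<close>
  define L where "L \<delta> = (2 * b)\<^sup>2 * q * (2 * b + 8 * e \<delta> * q)" for \<delta>
  have le: "norm x0 powr \<alpha> * max (u x0) 0 powr m \<le> L \<delta>" if "\<delta> > 0" for \<delta>
  proof -
    define \<phi> where "\<phi> = sqdist_poly y (A * q powr p - b * q + e \<delta> * q\<^sup>2) (b - 2 * e \<delta> * q) (e \<delta>)"
    have \<phi>: "\<phi> x = A * q powr p + b * (Q x - q) + e \<delta> * (Q x - q)\<^sup>2" for x
      by (simp add: \<phi>_def sqdist_poly_def Q_def power2_eq_square algebra_simps)
    have "(Q \<longlongrightarrow> q) (nhds x0)"
      unfolding Q_def q_def by (intro tendsto_intros filterlim_ident)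
    then have "\<forall>\<^sub>F x in nhds x0. Q x powr p \<le> q powr p + p * q powr (p - 1) * (Q x - q)
           + (p * (p - 1) * q powr (p - 2) / 2 + \<delta>) * (Q x - q)\<^sup>2"
      using powr_le_quadratic_near [OF q that, of p] unfolding filterlim_iff by blast
    then have "\<forall>\<^sub>F x in nhds x0. A * norm (x - y) powr \<sigma> \<le> \<phi> x"
    proof eventually_elim
      case (elim x)
      then have "A * Q x powr p \<le> A * (q powr p + p * q powr (p - 1) * (Q x - q)
           + (p * (p - 1) * q powr (p - 2) / 2 + \<delta>) * (Q x - q)\<^sup>2)"
        using \<open>A \<ge> 0\<close> by (rule mult_left_mono)
      moreover have "A * norm (x - y) powr \<sigma> = A * Q x powr p"
        by (simp add: norm_powr_eq_sqdist_powr Q_def p_def)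
      moreover have "\<phi> x = A * (q powr p + p * q powr (p - 1) * (Q x - q)
           + (p * (p - 1) * q powr (p - 2) / 2 + \<delta>) * (Q x - q)\<^sup>2)"
        unfolding \<phi> b_def e_def by (simp add: algebra_simps)
      ultimately show ?case by linarith
    qed
    moreover have "\<phi> x0 = A * norm (x0 - y) powr \<sigma>"
      by (simp add: \<phi> norm_powr_eq_sqdist_powr q_def Q_def p_def)
    ultimately have "local_max_at (\<lambda>x. u x - \<phi> x) x0"
      by (rule local_max_at_mono [OF max])
    then have "norm x0 powr \<alpha> * max (u x0) 0 powr m \<le> inf_laplacian \<phi> x0"
      using sub x0(1) C2_on_sqdist_poly unfolding viscosity_subsolution_def \<phi>_def by blast
    also have "\<dots> = L \<delta>"
      unfolding \<phi>_def inf_laplacian_sqdist_poly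
      by (simp add: L_def q_def Q_def algebra_simps)
    finally show ?thesis .
  qed
  have "(L \<longlongrightarrow> L 0) (at_right 0)"
    unfolding L_def e_def by (intro tendsto_intros)
  then have "norm x0 powr \<alpha> * max (u x0) 0 powr m \<le> L 0"
    using le by (intro tendsto_lowerbound [of L "L 0" "at_right 0"])
      (auto simp: eventually_at_right_less eventually_at_filter)
  also have "L 0 = 8 * A ^ 3 * p ^ 3 * (2 * p - 1) * q powr (3 * p - 2)"
  proof -
    define s where "s = q powr (p - 1)"
    have e1: "e 0 * q = A * (p * (p - 1) * s / 2)"
      using q by (simp add: e_def s_def powr_diff powr_numeral field_simps power2_eq_square)
    have "q powr (3 * p - 2) = q powr ((p - 1) + (p - 1) + (p - 1) + 1)"
      by (simp add: algebra_simps)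
    then have "q powr (3 * p - 2) = s ^ 3 * q"
      using q unfolding powr_add by (simp add: s_def power3_eq_cube)
    moreover have "L 0 = (2 * b)\<^sup>2 * q * (2 * b + 8 * (e 0 * q))"
      by (simp add: L_def)
    ultimately show ?thesis
      unfolding e1 b_def s_def [symmetric]
      by (simp add: power2_eq_square power3_eq_cube field_simps)
  qed
  also have "\<dots> = A ^ 3 * \<sigma> ^ 3 * (\<sigma> - 1) * norm (x0 - y) powr (3 * \<sigma> - 4)"
    by (simp add: norm_powr_eq_sqdist_powr p_def q_def Q_def power3_eq_cube diff_divide_distrib)
  finally show ?thesis .
qed

text \<open>
  At its centre, a power with exponent above \<open>2\<close> is touched from above by \<open>|x - y|\<^sup>2\<close>, whose
  gradient vanishes there.
\<close>

lemma subsolution_touch_radial_power_centre: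
  fixes u :: "real ^ 'n \<Rightarrow> real"
  assumes sub: "viscosity_subsolution \<alpha> m u" and y: "y \<in> ball 0 1" and "\<sigma> > 2"
    and max: "local_max_at (\<lambda>x. u x - A * norm (x - y) powr \<sigma>) y"
  shows "norm y powr \<alpha> * max (u y) 0 powr m \<le> 0"
proof -
  define \<phi> where "\<phi> = sqdist_poly y 0 1 0"
  have \<phi>: "\<phi> x = (norm (x - y))\<^sup>2" for x
    by (simp add: \<phi>_def sqdist_poly_def dot_square_norm)
  have "((\<lambda>x. A * norm (x - y) powr (\<sigma> - 2)) \<longlongrightarrow> A * norm (y - y) powr (\<sigma> - 2)) (nhds y)"
    using \<open>\<sigma> > 2\<close> by (intro tendsto_intros tendsto_powr' filterlim_ident) auto
  then have "\<forall>\<^sub>F x in nhds y. A * norm (x - y) powr (\<sigma> - 2) < 1"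
    by (rule order_tendstoD) auto
  then have "\<forall>\<^sub>F x in nhds y. A * norm (x - y) powr \<sigma> \<le> \<phi> x"
  proof eventually_elim
    case (elim x)
    show ?case
    proof (cases "x = y")
      case False
      then have "norm (x - y) powr \<sigma> = norm (x - y) powr (\<sigma> - 2) * (norm (x - y))\<^sup>2"
        by (simp add: powr_diff)
      with mult_right_mono [of "A * norm (x - y) powr (\<sigma> - 2)" 1 "(norm (x - y))\<^sup>2"] elim
      show ?thesis by (simp add: \<phi> mult.assoc)
    qed (simp add: \<phi>)
  qed
  then have "local_max_at (\<lambda>x. u x - \<phi> x) y"
    by (rule local_max_at_mono [OF max]) (simp add: \<phi>)
  then have "norm y powr \<alpha> * max (u y) 0 powr m \<le> inf_laplacian \<phi> y"
    using sub y C2_on_sqdist_poly unfolding viscosity_subsolution_def \<phi>_def by blast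
  then show ?thesis
    by (simp add: \<phi>_def inf_laplacian_sqdist_poly)
qed

section \<open>Comparison with radial powers\<close>

text \<open>
  The assumption \<open>super\<close> is \<open>\<Delta>\<^sub>\<infinity> w \<le> |x|\<^sup>\<alpha> w\<^sup>m\<close> for \<open>w = A |x - y|\<^sup>\<sigma>\<close> away from \<open>y\<close>, divided by
  \<open>w\<^sup>m\<close>. It implies \<open>x \<noteq> 0\<close>, because its left-hand side is positive and \<open>0 powr \<alpha> = 0\<close>.
\<close>

lemma subsolution_le_radial_power:
  fixes u :: "real ^ 'n \<Rightarrow> real"
  assumes sub: "viscosity_subsolution \<alpha> m u" and "m > 0"
    and dom: "cball y d \<subseteq> ball 0 1" and "d > 0" and "A > 0" and "\<sigma> > 1"
    and super: "\<And>x. x \<in> ball y d \<Longrightarrow> x \<noteq> y \<Longrightarrow>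
      A powr (3 - m) * (\<sigma> ^ 3 * (\<sigma> - 1)) * norm (x - y) powr ((3 - m) * \<sigma> - 4) \<le> norm x powr \<alpha>"
    and centre: "u y \<le> 0 \<or> \<sigma> > 2 \<and> y \<noteq> 0"
    and bdry: "\<And>x. x \<in> sphere y d \<Longrightarrow> u x \<le> A * d powr \<sigma>"
    and x: "x \<in> cball y d"
  shows "u x \<le> A * norm (x - y) powr \<sigma>"
proof (rule ccontr)
  define w where "w x = A * norm (x - y) powr \<sigma>" for x
  assume "\<not> u x \<le> A * norm (x - y) powr \<sigma>"
  then have pos: "u x - w x > 0" by (simp add: w_def)
  have "continuous_on (cball y d) u"
    using sub dom continuous_on_subset unfolding viscosity_subsolution_def by blast
  then have "continuous_on (cball y d) (\<lambda>x. u x - w x)"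
    unfolding w_def using \<open>\<sigma> > 1\<close>
    by (intro continuous_intros continuous_on_powr') auto
  then obtain x0 where x0: "x0 \<in> cball y d" "\<And>z. z \<in> cball y d \<Longrightarrow> u z - w z \<le> u x0 - w x0"
    using continuous_attains_sup [OF compact_cball] x by blast
  then have pos0: "u x0 > w x0" using pos x by fastforce
  have w0: "w x0 \<ge> 0" using \<open>A > 0\<close> by (simp add: w_def)
  have "x0 \<notin> sphere y d"
    using bdry [of x0] pos0 by (auto simp: w_def dist_norm norm_minus_commute)
  then have ball: "x0 \<in> ball y d" using x0(1) by auto
  have "\<forall>\<^sub>F z in nhds x0. z \<in> ball y d"
    using ball by (intro eventually_nhds_in_open) auto
  then have max: "local_max_at (\<lambda>x. u x - A * norm (x - y) powr \<sigma>) x0"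
    unfolding local_max_at_def by eventually_elim (use x0(2) in \<open>auto simp: w_def\<close>)
  have B1: "x0 \<in> ball 0 1" using x0(1) dom by blast
  show False
  proof (cases "x0 = y")
    case True
    then have "\<sigma> > 2" "y \<noteq> 0" using centre pos0 w0 by auto
    with subsolution_touch_radial_power_centre [OF sub, of y \<sigma> A] max B1 True
    have "norm y powr \<alpha> * max (u y) 0 powr m \<le> 0" by simp
    moreover have "norm y powr \<alpha> * max (u y) 0 powr m > 0"
      using True pos0 w0 \<open>y \<noteq> 0\<close> by auto
    ultimately show False by simp
  next
    case False
    define \<rho> where "\<rho> = norm (x0 - y)"
    have \<rho>: "\<rho> > 0" using False by (simp add: \<rho>_def)
    have S: "A powr (3 - m) * (\<sigma> ^ 3 * (\<sigma> - 1)) * \<rho> powr ((3 - m) * \<sigma> - 4) \<le> norm x0 powr \<alpha>"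
      using super [OF ball False] by (simp add: \<rho>_def)
    have "A powr (3 - m) * (\<sigma> ^ 3 * (\<sigma> - 1)) * \<rho> powr ((3 - m) * \<sigma> - 4) > 0"
      using \<open>A > 0\<close> \<open>\<sigma> > 1\<close> \<rho> by simp
    with S have nz: "norm x0 powr \<alpha> > 0" by linarith
    have "A ^ 3 * \<sigma> ^ 3 * (\<sigma> - 1) * \<rho> powr (3 * \<sigma> - 4)
      = (A powr (3 - m) * (\<sigma> ^ 3 * (\<sigma> - 1)) * \<rho> powr ((3 - m) * \<sigma> - 4)) * (w x0 powr m)"
    proof -
      have "A powr (3 - m) * A powr m = A ^ 3"
        using \<open>A > 0\<close> by (simp flip: powr_add)
      moreover have "\<rho> powr ((3 - m) * \<sigma> - 4) * \<rho> powr (\<sigma> * m) = \<rho> powr (3 * \<sigma> - 4)"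
        by (simp add: algebra_simps flip: powr_add)
      moreover have "w x0 powr m = A powr m * \<rho> powr (\<sigma> * m)"
        using \<open>A > 0\<close> \<rho> by (simp add: w_def \<rho>_def powr_mult powr_powr)
      ultimately show ?thesis by (simp add: mult_ac)
    qed
    also have "\<dots> \<le> norm x0 powr \<alpha> * w x0 powr m"
      using S by (rule mult_right_mono) simp
    also have "\<dots> < norm x0 powr \<alpha> * max (u x0) 0 powr m"
      using nz pos0 w0 \<open>m > 0\<close> by (intro mult_strict_left_mono powr_less_mono2) auto
    also have "\<dots> \<le> A ^ 3 * \<sigma> ^ 3 * (\<sigma> - 1) * \<rho> powr (3 * \<sigma> - 4)"
      unfolding \<rho>_def using \<open>A > 0\<close> by (intro subsolution_touch_radial_power [OF sub B1 False _ max]) simp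
    finally show False by simp
  qed
qed

section \<open>Nondegeneracy at the free boundary\<close>

text \<open>
  A power \<open>A |x|\<^sup>\<gamma>\<close> with \<open>\<gamma> > \<beta>\<close> is a supersolution in the ball of radius \<open>r\<close> as soon as it
  is one at distance \<open>r\<close> from \<open>0\<close>. The largest admissible \<open>A\<close> depends continuously on \<open>\<gamma>\<close>, so the
  strict inequality \<open>S\<close> leaves room to increase the exponent.
\<close>

lemma subsolution_faster_decay:
  fixes u :: "real ^ 'n \<Rightarrow> real"
  assumes sub: "viscosity_subsolution \<alpha> m u" and "m > 0" and "m < 3" and "\<alpha> > 0"
    and r: "0 < r" "r < 1" and "u 0 \<le> 0"
    and \<beta>: "\<beta> = (4 + \<alpha>) / (3 - m)"
    and bdry: "\<And>x. x \<in> sphere 0 r \<Longrightarrow> u x \<le> S"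
    and S: "S < (1 / (\<beta> ^ 3 * (\<beta> - 1))) powr (1 / (3 - m)) * r powr \<beta>"
  obtains A \<gamma> where "A > 0" "\<gamma> > \<beta>" "\<And>x. x \<in> cball 0 r \<Longrightarrow> u x \<le> A * norm x powr \<gamma>"
proof -
  have "\<beta> > 1" using assms(2-4) by (simp add: \<beta> field_simps)
  define K where "K \<gamma> = (1 / (\<gamma> ^ 3 * (\<gamma> - 1))) powr (1 / (3 - m))" for \<gamma> :: real
  have "((\<lambda>\<gamma>. K \<gamma> * r powr \<beta>) \<longlongrightarrow> K \<beta> * r powr \<beta>) (at_right \<beta>)"
    unfolding K_def using \<open>\<beta> > 1\<close> by (intro tendsto_intros) auto
  then have "\<forall>\<^sub>F \<gamma> in at_right \<beta>. S < K \<gamma> * r powr \<beta>"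
    using S by (intro order_tendstoD) (auto simp: K_def)
  then have "\<forall>\<^sub>F \<gamma> in at_right \<beta>. S < K \<gamma> * r powr \<beta> \<and> \<gamma> > \<beta>"
    using eventually_at_right_less by (rule eventually_conj)
  then obtain \<gamma> where \<gamma>: "S < K \<gamma> * r powr \<beta>" "\<gamma> > \<beta>"
    using eventually_happens' [OF trivial_limit_at_right_real] by blast
  \<comment> \<open>The largest factor for which \<open>A |x|\<^sup>\<gamma>\<close> is a supersolution in the ball of radius \<open>r\<close>\<close>
  define A where "A = K \<gamma> * r powr (\<beta> - \<gamma>)"
  have "K \<gamma> > 0" using \<gamma> \<open>\<beta> > 1\<close> by (simp add: K_def)
  then have "A > 0" using r by (simp add: A_def)
  have "u x \<le> A * norm (x - 0) powr \<gamma>" if "x \<in> cball 0 r" for x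
  proof (rule subsolution_le_radial_power [OF sub \<open>m > 0\<close> _ r(1) \<open>A > 0\<close> _ _ _ _ that])
    show "cball (0 :: real ^ 'n) r \<subseteq> ball 0 1" using r by auto
    show "\<gamma> > 1" using \<gamma> \<open>\<beta> > 1\<close> by simp
    show "u 0 \<le> 0 \<or> \<gamma> > 2 \<and> (0 :: real ^ 'n) \<noteq> 0" using \<open>u 0 \<le> 0\<close> by simp
    show "u x \<le> A * r powr \<gamma>" if "x \<in> sphere 0 r" for x
    proof -
      have "A * r powr \<gamma> = K \<gamma> * r powr \<beta>"
        using r by (simp add: A_def mult.assoc flip: powr_add)
      then show ?thesis using bdry [OF that] \<gamma>(1) by simp
    qed
    show "A powr (3 - m) * (\<gamma> ^ 3 * (\<gamma> - 1)) * norm (x - 0) powr ((3 - m) * \<gamma> - 4) \<le> norm x powr \<alpha>"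
      if x: "x \<in> ball 0 r" "x \<noteq> 0" for x :: "real ^ 'n"
    proof -
      define \<kappa> where "\<kappa> = (3 - m) * (\<gamma> - \<beta>)"
      have "\<kappa> > 0" using \<gamma> \<open>m < 3\<close> by (simp add: \<kappa>_def)
      have e: "(3 - m) * \<gamma> - 4 = \<kappa> + \<alpha>"
        using \<open>m < 3\<close> by (simp add: \<kappa>_def \<beta> field_simps)
      have "A powr (3 - m) = 1 / (\<gamma> ^ 3 * (\<gamma> - 1)) * r powr (- \<kappa>)"
        using \<gamma> \<open>\<beta> > 1\<close> \<open>m < 3\<close> r
        by (simp add: A_def K_def powr_mult powr_powr \<kappa>_def algebra_simps)
      then have "A powr (3 - m) * (\<gamma> ^ 3 * (\<gamma> - 1)) = r powr (- \<kappa>)"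
        using \<gamma> \<open>\<beta> > 1\<close> by simp
      then have "A powr (3 - m) * (\<gamma> ^ 3 * (\<gamma> - 1)) * norm (x - 0) powr ((3 - m) * \<gamma> - 4)
         = (norm x powr \<kappa> / r powr \<kappa>) * norm x powr \<alpha>"
        unfolding e by (simp add: powr_add powr_minus field_simps)
      also have "\<dots> \<le> 1 * norm x powr \<alpha>"
        using x r \<open>\<kappa> > 0\<close> by (intro mult_right_mono) (auto simp: powr_mono2)
      finally show ?thesis by simp
    qed
  qed
  with that [OF \<open>A > 0\<close> \<gamma>(2)] show ?thesis by simp
qed

text \<open>
  The barrier at a point \<open>y \<noteq> 0\<close> is \<open>B |x - y|\<^bsup>\<gamma>+1\<^esup>\<close> on the ball of radius \<open>d = |y| / 2\<close>,
  where \<open>d \<le> |x| \<le> 3 d\<close>. The exponent \<open>\<gamma> + 1\<close> exceeds both \<open>2\<close>, so that the centre is harmless, and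
  \<open>4 / (3 - m)\<close>, so that the left-hand side of the barrier condition increases with \<open>|x - y|\<close>; \<open>B\<close> is chosen so
  that the barrier equals \<open>A (3 d)\<^sup>\<gamma>\<close> on that sphere.
\<close>

lemma subsolution_nonpos_near_0:
  fixes u :: "real ^ 'n \<Rightarrow> real"
  assumes sub: "viscosity_subsolution \<alpha> m u" and "m > 0" and "m < 3" and "\<alpha> > 0"
    and r: "0 < r" "r < 1" and "A > 0" and \<gamma>: "(3 - m) * \<gamma> > 4 + \<alpha>"
    and decay: "\<And>x. x \<in> cball 0 r \<Longrightarrow> u x \<le> A * norm x powr \<gamma>"
  shows "\<forall>\<^sub>F y in nhds 0. u y \<le> 0"
proof -
  define \<sigma> where "\<sigma> = \<gamma> + 1"
  have "\<gamma> > 1"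
  proof (rule ccontr)
    assume "\<not> \<gamma> > 1"
    then have "(3 - m) * \<gamma> \<le> (3 - m) * 1" using \<open>m < 3\<close> by (intro mult_left_mono) auto
    with \<gamma> \<open>\<alpha> > 0\<close> \<open>m > 0\<close> show False by simp
  qed
  \<comment> \<open>The barrier condition reduces to \<open>C d\<^sup>\<kappa> \<le> 1\<close>, which holds for small \<open>d\<close>.\<close>
  define C where "C = (A * 3 powr \<gamma>) powr (3 - m) * (\<sigma> ^ 3 * (\<sigma> - 1))"
  define \<kappa> where "\<kappa> = (3 - m) * \<gamma> - 4 - \<alpha>"
  have "\<kappa> > 0" using \<gamma> by (simp add: \<kappa>_def)
  have "((\<lambda>y :: real ^ 'n. C * (norm y / 2) powr \<kappa>) \<longlongrightarrow> C * (norm (0 :: real ^ 'n) / 2) powr \<kappa>) (nhds 0)"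
    using \<open>\<kappa> > 0\<close> by (intro tendsto_intros tendsto_powr' filterlim_ident) auto
  then have "\<forall>\<^sub>F y in nhds (0 :: real ^ 'n). C * (norm y / 2) powr \<kappa> < 1"
    by (rule order_tendstoD) auto
  moreover have "\<forall>\<^sub>F y in nhds (0 :: real ^ 'n). y \<in> ball 0 (r / 2)"
    using r by (intro eventually_nhds_in_open) auto
  ultimately show ?thesis
  proof eventually_elim
    case (elim y)
    show ?case
    proof (cases "y = 0")
      case True
      then show ?thesis using decay [of 0] r \<open>\<gamma> > 1\<close> by simp
    next
      case False
      define d where "d = norm y / 2"
      have "d > 0" using False by (simp add: d_def)
      have cb: "x \<in> cball 0 r" and nx: "norm x \<le> 3 * d" "d \<le> norm x" if "x \<in> cball y d" for x
        using that elim(2) norm_triangle_ineq2 [of x y] norm_triangle_ineq2 [of y x]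
        by (auto simp: d_def dist_norm norm_minus_commute)
      define B where "B = A * 3 powr \<gamma> / d"
      have "B > 0" using \<open>A > 0\<close> \<open>d > 0\<close> by (simp add: B_def)
      have "u y \<le> B * norm (y - y) powr \<sigma>"
      proof (rule subsolution_le_radial_power [OF sub \<open>m > 0\<close> _ \<open>d > 0\<close> \<open>B > 0\<close>])
        show "cball y d \<subseteq> ball 0 1" using cb r by force
        show "\<sigma> > 1" "u y \<le> 0 \<or> \<sigma> > 2 \<and> y \<noteq> 0" "y \<in> cball y d"
          using \<open>\<gamma> > 1\<close> False \<open>d > 0\<close> by (auto simp: \<sigma>_def)
        show "u x \<le> B * d powr \<sigma>" if "x \<in> sphere y d" for x
        proof -
          have "x \<in> cball y d" using that by auto
          then have "u x \<le> A * norm x powr \<gamma>" "norm x \<le> 3 * d" by (blast intro: decay cb nx)+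
          moreover have "A * norm x powr \<gamma> \<le> A * (3 * d) powr \<gamma>"
            using calculation \<open>A > 0\<close> \<open>\<gamma> > 1\<close> by (intro mult_left_mono powr_mono2) auto
          moreover have "A * (3 * d) powr \<gamma> = B * d powr \<sigma>"
            using \<open>d > 0\<close> by (simp add: B_def \<sigma>_def powr_mult powr_add)
          ultimately show ?thesis by linarith
        qed
        show "B powr (3 - m) * (\<sigma> ^ 3 * (\<sigma> - 1)) * norm (x - y) powr ((3 - m) * \<sigma> - 4)
          \<le> norm x powr \<alpha>" if x: "x \<in> ball y d" "x \<noteq> y" for x
        proof -
          have e: "(3 - m) * \<sigma> - 4 = \<kappa> + \<alpha> + (3 - m)"
            by (simp add: \<sigma>_def \<kappa>_def algebra_simps)
          have "norm (x - y) powr ((3 - m) * \<sigma> - 4) \<le> d powr ((3 - m) * \<sigma> - 4)"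
            using x \<open>\<kappa> > 0\<close> \<open>\<alpha> > 0\<close> \<open>m < 3\<close> unfolding e
            by (intro powr_mono2) (auto simp: dist_norm norm_minus_commute)
          then have "B powr (3 - m) * (\<sigma> ^ 3 * (\<sigma> - 1)) * norm (x - y) powr ((3 - m) * \<sigma> - 4)
            \<le> B powr (3 - m) * (\<sigma> ^ 3 * (\<sigma> - 1)) * d powr ((3 - m) * \<sigma> - 4)"
            using \<open>\<gamma> > 1\<close> by (intro mult_left_mono) (auto simp: \<sigma>_def)
          also have "\<dots> = C * d powr \<kappa> * d powr \<alpha>"
            using \<open>A > 0\<close> \<open>d > 0\<close> unfolding e
            by (simp add: B_def C_def powr_divide powr_add)
          also have "\<dots> \<le> 1 * d powr \<alpha>"
            using elim(1) by (intro mult_right_mono) (auto simp: d_def)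
          also have "\<dots> \<le> norm x powr \<alpha>"
            using nx(2) [of x] x \<open>d > 0\<close> \<open>\<alpha> > 0\<close> by (simp add: powr_mono2)
          finally show ?thesis .
        qed
      qed
      then show ?thesis by simp
    qed
  qed
qed

theorem theorem1p3:
  fixes u :: "real ^ 'n \<Rightarrow> real" and \<alpha> m :: real
  assumes "CARD('n) \<ge> 2"
    and "\<alpha> > 0"
    and "0 < m" and "m < 3"
    and "continuous_on (ball 0 1) u"
    and "\<forall>x\<in>ball 0 1. u x \<ge> 0"
    and "viscosity_solution \<alpha> m u"
    and "0 \<in> frontier {x \<in> ball 0 1. u x > 0}"
  shows "\<exists>rstar>0. \<forall>r. 0 < r \<and> r < rstar \<and> ball (0 :: real ^ 'n) r \<subseteq> ball 0 1 \<longrightarrow>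
    (SUP x\<in>sphere 0 r. u x) \<ge>
      ((3 - m) ^ 4 / ((4 + \<alpha>) ^ 3 * (1 + \<alpha> + m))) powr (1 / (3 - m)) *
      r powr ((4 + \<alpha>) / (3 - m))"
proof (intro exI [of _ 1] conjI allI impI)
  fix r :: real assume "0 < r \<and> r < 1 \<and> ball (0 :: real ^ 'n) r \<subseteq> ball 0 1"
  then have r: "0 < r" "r < 1" by auto
  define \<beta> where "\<beta> = (4 + \<alpha>) / (3 - m)"
  define P where "P = {x \<in> ball 0 1. u x > 0}"
  have sub: "viscosity_subsolution \<alpha> m u"
    using assms(7) by (simp add: viscosity_solution_def)
  have "\<beta> - 1 = (1 + \<alpha> + m) / (3 - m)"
    using \<open>m < 3\<close> by (simp add: \<beta>_def field_simps)
  then have const: "(3 - m) ^ 4 / ((4 + \<alpha>) ^ 3 * (1 + \<alpha> + m)) = 1 / (\<beta> ^ 3 * (\<beta> - 1))"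
    using \<open>m < 3\<close> by (simp add: \<beta>_def power_divide eval_nat_numeral)
  \<comment> \<open>As \<open>P\<close> is open, its frontier point \<open>0\<close> lies in its closure but not in \<open>P\<close>.\<close>
  have "open P"
  proof -
    have "P = ball 0 1 \<inter> u -` {0<..}" by (auto simp: P_def)
    then show ?thesis
      using continuous_open_preimage [OF assms(5)] by simp
  qed
  then have 0: "0 \<in> closure P" "0 \<notin> P"
    using assms(8) interior_open [of P] unfolding P_def [symmetric] frontier_def by auto
  then have "u 0 \<le> 0" by (simp add: P_def)
  have "bdd_above (u ` sphere 0 r)"
  proof -
    have "continuous_on (sphere 0 r) u"
      using assms(5) by (rule continuous_on_subset) (use r in auto)
    then show ?thesis
      by (intro bounded_imp_bdd_above compact_imp_bounded compact_continuous_image) auto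
  qed
  then have bdry: "u x \<le> (SUP x\<in>sphere 0 r. u x)" if "x \<in> sphere 0 r" for x
    using that by (rule cSUP_upper2) auto
  show "(SUP x\<in>sphere 0 r. u x) \<ge>
      ((3 - m) ^ 4 / ((4 + \<alpha>) ^ 3 * (1 + \<alpha> + m))) powr (1 / (3 - m)) *
      r powr ((4 + \<alpha>) / (3 - m))"
  proof (rule ccontr)
    assume "\<not> ?thesis"
    then have "(SUP x\<in>sphere 0 r. u x) < (1 / (\<beta> ^ 3 * (\<beta> - 1))) powr (1 / (3 - m)) * r powr \<beta>"
      unfolding const \<beta>_def [symmetric] by simp
    then obtain A \<gamma> where A: "A > 0" "\<gamma> > \<beta>"
      "\<And>x. x \<in> cball 0 r \<Longrightarrow> u x \<le> A * norm x powr \<gamma>"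
      using subsolution_faster_decay [OF sub assms(3,4,2) r \<open>u 0 \<le> 0\<close> \<beta>_def bdry] by blast
    have "(3 - m) * \<gamma> > 4 + \<alpha>"
      using A(2) \<open>m < 3\<close> by (simp add: \<beta>_def field_simps)
    then have "\<forall>\<^sub>F y in nhds 0. u y \<le> 0"
      by (rule subsolution_nonpos_near_0 [OF sub assms(3,4,2) r A(1) _ A(3)])
    then obtain U where "open U" "0 \<in> U" "\<forall>y\<in>U. u y \<le> 0"
      by (auto simp: eventually_nhds)
    then have "U \<inter> P = {}" by (force simp: P_def)
    then have "U \<inter> closure P = {}"
      using \<open>open U\<close> by (simp add: open_Int_closure_eq_empty)
    with \<open>0 \<in> U\<close> 0(1) show False by blast
  qed
qed simp

end
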